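(* Let $\epsilon>0$, $n\ge2$, $N\in\{2n,2n+1\}$, and let $p=\frac{1}{e^\epsilon+N-1}$, $t=(e^\epsilon-1)p$; this corresponds to the structured $N$-output mechanism with $p_0=0$ if $N=2n$ and $p_0=p$ if $N=2n+1$. Let $\Omega^{(0)}=\{a^{(0)}_j\}$ be the candidate sequence defined in the context for these parameters, and suppose that $a^{(0)}_j<a^{(0)}_{j+1}$ for all $j\in\{0,\dots,n-1\}$ and that, computed with $\Omega^{(0)}$, $\mathrm{Var}_1[Y\mid x_1^*]>\mathrm{Var}_n[Y\mid x_n^*]$. Define $$C_1=\begin{cases}\frac{1}{4t-1}&\text{if }N=2n,\\[2pt] \frac1{4t-2}&\text{if }N=2n+1,\end{cases}\qquad C_{j+1}=\frac{1-2t+\sqrt{C_j^2+2C_j-4tC_j+(2t-1)^2}}{C_j^2+2C_j-4tC_j}\quad(1\le j\le n-2),$$ and $$a_n=\frac1t,\qquad a_j=C_ja_{j+1}\quad\text{for } j\in\{1,2,\dots,n-1\},$$ with $a_0=0$, $a_{-j}=-a_j$. Then the sequence $(a_j)$ minimizes the worst-case noise variance $\max_{x\in[-1,1]}\mathrm{Var}[Y\mid x]$ among all admissible output sets for the given $\epsilon$, $N$ and this $p$ (equivalently this $p_0$).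
   Context: Structured $N$-output mechanism. Let $\epsilon>0$, $n\ge1$, $N=2n$ or $N=2n+1$. Let $p_0$ be a parameter and set $$p=\frac{1-p_0}{e^\epsilon+2n-1},\qquad p^*=\frac{1-2(n-1)p-e^\epsilon p_0}{2},\qquad t=(e^\epsilon-1)p .$$ It is required that $0\le p_0\le p$; if $N=2n$ then $p_0=0$ (the output $a_0$ is not used and has probability $0$). With $p_0=0$ for $N=2n$, or $p_0=p$ for $N=2n+1$, one gets $p=\frac1{e^\epsilon+N-1}$. An admissible output set $\Omega$ is given by reals $a_{-n}<a_{-n+1}<\dots<a_n$ with $a_{-i}=-a_i$, $a_0=0$ and $a_n=1/t$; $\Omega=\{a_i\}_{i=-n}^n$ if $N=2n+1$ and $\Omega=\{a_i\}_{i=-n}^n\setminus\{a_0\}$ if $N=2n$. For $i,j\in\{-n,\dots,n\}$ define $P_{i,j}$ by: for $i=0$: $P_{0,0}=e^\epsilon p_0$ and $P_{0,j}=p_0$ for $j\ne0$; for $|i|>1$: $P_{i,i}=e^\epsilon p$ and $P_{i,j}=p$ for $j\neq i$; for $|i|=1$: $P_{i,i}=e^\epsilon p$, $P_{i,0}=p^*$, and $P_{i,j}=p$ for all other $j$. Put $x_j=\sum_{i=-n}^n a_iP_{i,j}$, which equals $ta_j$; thus $-1=x_{-n}<\dots<x_n=1$. On input $x\in[-1,1]$ the mechanism outputs $a_i$ with probability $p_i(x)$, where $p_i$ is the continuous function that is affine on each $[x_{j-1},x_j]$ with $p_i(x_j)=P_{i,j}$. The noise variance is $\mathrm{Var}[Y\mid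 x]=\sum_{i=-n}^n a_i^2p_i(x)-x^2$; it is even in $x$. For $j\in\{1,\dots,n\}$, $\mathrm{Var}_j[Y\mid x]$ denotes the quadratic polynomial giving $\mathrm{Var}[Y\mid x]$ on $[x_{j-1},x_j]$, evaluated at any real $x$: $$\mathrm{Var}_1[Y\mid x]=-x^2+\frac{a_1(e^\epsilon p+p-2p^* )}{(e^\epsilon-1)p}x+2a_1^2p^*+2\sum_{i=2}^na_i^2p,$$ $$\mathrm{Var}_j[Y\mid x]=-x^2+(a_{j-1}+a_j)x-(e^\epsilon-1)p\,a_{j-1}a_j+2\sum_{i=1}^na_i^2p\qquad(j\ge2).$$ Also $x_1^*=\frac{a_1(e^\epsilon p+p-2p^* )}{2(e^\epsilon-1)p}$ and $x_n^*=\frac{a_{n-1}+a_n}{2}$. Candidate sequence $\Omega^{(0)}$: put $T_n=0$, $T_{n-1}=1$, $Q_n=1$, $Q_{n-1}=0$, and $T_i=(4t-2)T_{i+1}-T_{i+2}$, $Q_i=(4t-2)Q_{i+1}-Q_{i+2}$ for $1\le i\le n-2$. Then $$a^{(0)}_n=\frac1t,\quad a^{(0)}_{n-1}=\frac{(2t-1)-8p\sum_{i=1}^nT_iQ_i}{1+8p\sum_{i=1}^nT_i^2}\,a^{(0)}_n,\quad a^{(0)}_j=(4t-2)a^{(0)}_{j+1}-a^{(0)}_{j+2}\ (1\le j\le n-2),$$ with $a^{(0)}_0=0$ and $a^{(0)}_{-j}=-a^{(0)}_j$. *)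

theory Defs
  imports "HOL-Analysis.Analysis"
begin

(* An output set is represented by the sequence a :: int => real of its points, of which only the
   entries with index in {-n..n} matter.  The case N = 2 n + 1 has p0 = p; for N = 2 n one takes
   p0 = 0, so that the point a 0 = 0 carries probability 0 and is not an actual output. *)

definition mech_p :: "real \<Rightarrow> nat \<Rightarrow> real \<Rightarrow> real" where
  "mech_p \<epsilon> n p0 = (1 - p0) / (exp \<epsilon> + 2 * real n - 1)"

definition mech_pstar :: "real \<Rightarrow> nat \<Rightarrow> real \<Rightarrow> real" where
  "mech_pstar \<epsilon> n p0 = (1 - 2 * (real n - 1) * mech_p \<epsilon> n p0 - exp \<epsilon> * p0) / 2"

definition mech_t :: "real \<Rightarrow> nat \<Rightarrow> real \<Rightarrow> real" where
  "mech_t \<epsilon> n p0 = (exp \<epsilon> - 1) * mech_p \<epsilon> n p0"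

definition admissible :: "real \<Rightarrow> nat \<Rightarrow> real \<Rightarrow> (int \<Rightarrow> real) \<Rightarrow> bool" where
  "admissible \<epsilon> n p0 a \<longleftrightarrow>
     (\<forall>i\<in>{- int n..<int n}. a i < a (i + 1)) \<and>
     (\<forall>i\<in>{- int n..int n}. a (- i) = - a i) \<and>
     a 0 = 0 \<and> a (int n) = 1 / mech_t \<epsilon> n p0"

definition mech_P :: "real \<Rightarrow> nat \<Rightarrow> real \<Rightarrow> int \<Rightarrow> int \<Rightarrow> real" where
  "mech_P \<epsilon> n p0 i j =
     (if i = 0 then (if j = 0 then exp \<epsilon> * p0 else p0)
      else if \<bar>i\<bar> = 1 then
        (if j = i then exp \<epsilon> * mech_p \<epsilon> n p0
         else if j = 0 then mech_pstar \<epsilon> n p0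
         else mech_p \<epsilon> n p0)
      else (if j = i then exp \<epsilon> * mech_p \<epsilon> n p0 else mech_p \<epsilon> n p0))"

definition mech_x :: "real \<Rightarrow> nat \<Rightarrow> real \<Rightarrow> (int \<Rightarrow> real) \<Rightarrow> int \<Rightarrow> real" where
  "mech_x \<epsilon> n p0 a j = (\<Sum>i\<in>{- int n..int n}. a i * mech_P \<epsilon> n p0 i j)"

(* The affine function of y through the points (x_(j-1), P_(i,j-1)) and (x_j, P_(i,j)). *)
definition prob_interp ::
  "real \<Rightarrow> nat \<Rightarrow> real \<Rightarrow> (int \<Rightarrow> real) \<Rightarrow> int \<Rightarrow> int \<Rightarrow> real \<Rightarrow> real" where
  "prob_interp \<epsilon> n p0 a i j y =
     mech_P \<epsilon> n p0 i (j - 1) +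
     (y - mech_x \<epsilon> n p0 a (j - 1)) / (mech_x \<epsilon> n p0 a j - mech_x \<epsilon> n p0 a (j - 1)) *
     (mech_P \<epsilon> n p0 i j - mech_P \<epsilon> n p0 i (j - 1))"

(* The probability p_i(y) of output a i on input y: the Min is the least j in {-n+1..n} with
   y \<le> x_j, so y lies in [x_(j-1), x_j].  See output_prob_on_segment below. *)
definition output_prob ::
  "real \<Rightarrow> nat \<Rightarrow> real \<Rightarrow> (int \<Rightarrow> real) \<Rightarrow> int \<Rightarrow> real \<Rightarrow> real" where
  "output_prob \<epsilon> n p0 a i y =
     prob_interp \<epsilon> n p0 a i (Min {j \<in> {- int n + 1..int n}. y \<le> mech_x \<epsilon> n p0 a j}) y"

definition noise_var :: "real \<Rightarrow> nat \<Rightarrow> real \<Rightarrow> (int \<Rightarrow> real) \<Rightarrow> real \<Rightarrow> real" where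
  "noise_var \<epsilon> n p0 a y =
     (\<Sum>i\<in>{- int n..int n}. (a i)\<^sup>2 * output_prob \<epsilon> n p0 a i y) - y\<^sup>2"

(* For admissible a the noise variance is continuous on {-1..1}, so this supremum is a maximum. *)
definition worst_var :: "real \<Rightarrow> nat \<Rightarrow> real \<Rightarrow> (int \<Rightarrow> real) \<Rightarrow> real" where
  "worst_var \<epsilon> n p0 a = (SUP y\<in>{-1..1}. noise_var \<epsilon> n p0 a y)"

(* The polynomial expression of the noise variance on the j-th segment [x_(j-1), x_j],
   1 \<le> j \<le> n, at an arbitrary real y. *)
definition var_poly :: "real \<Rightarrow> nat \<Rightarrow> real \<Rightarrow> (int \<Rightarrow> real) \<Rightarrow> int \<Rightarrow> real \<Rightarrow> real" where
  "var_poly \<epsilon> n p0 a j y =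
     (let p = mech_p \<epsilon> n p0; pstar = mech_pstar \<epsilon> n p0 in
      if j = 1 then
        - y\<^sup>2 + a 1 * (exp \<epsilon> * p + p - 2 * pstar) / ((exp \<epsilon> - 1) * p) * y
        + 2 * (a 1)\<^sup>2 * pstar + 2 * (\<Sum>i\<in>{2..int n}. (a i)\<^sup>2 * p)
      else
        - y\<^sup>2 + (a (j - 1) + a j) * y - (exp \<epsilon> - 1) * p * a (j - 1) * a j
        + 2 * (\<Sum>i\<in>{1..int n}. (a i)\<^sup>2 * p))"

definition xstar_1 :: "real \<Rightarrow> nat \<Rightarrow> real \<Rightarrow> (int \<Rightarrow> real) \<Rightarrow> real" where
  "xstar_1 \<epsilon> n p0 a =
     a 1 * (exp \<epsilon> * mech_p \<epsilon> n p0 + mech_p \<epsilon> n p0 - 2 * mech_pstar \<epsilon> n p0) /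
     (2 * (exp \<epsilon> - 1) * mech_p \<epsilon> n p0)"

definition xstar_n :: "nat \<Rightarrow> (int \<Rightarrow> real) \<Rightarrow> real" where
  "xstar_n n a = (a (int n - 1) + a (int n)) / 2"

(* The recurrence s_i = (4 t - 2) s_(i+1) - s_(i+2), run downwards from s_n = u and s_(n-1) = v;
   the last argument is the distance n - i from the top index. *)
fun down_rec :: "real \<Rightarrow> real \<Rightarrow> real \<Rightarrow> nat \<Rightarrow> real" where
  "down_rec t u v 0 = u"
| "down_rec t u v (Suc 0) = v"
| "down_rec t u v (Suc (Suc k)) = (4 * t - 2) * down_rec t u v (Suc k) - down_rec t u v k"

definition cand_T :: "real \<Rightarrow> nat \<Rightarrow> nat \<Rightarrow> real" where
  "cand_T t n i = down_rec t 0 1 (n - i)"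

definition cand_Q :: "real \<Rightarrow> nat \<Rightarrow> nat \<Rightarrow> real" where
  "cand_Q t n i = down_rec t 1 0 (n - i)"

definition cand_pos :: "real \<Rightarrow> real \<Rightarrow> nat \<Rightarrow> nat \<Rightarrow> real" where
  "cand_pos p t n i =
     down_rec t (1 / t)
       (((2 * t - 1) - 8 * p * (\<Sum>k=1..n. cand_T t n k * cand_Q t n k)) /
        (1 + 8 * p * (\<Sum>k=1..n. (cand_T t n k)\<^sup>2)) * (1 / t))
       (n - i)"

definition cand :: "real \<Rightarrow> real \<Rightarrow> nat \<Rightarrow> int \<Rightarrow> real" where
  "cand p t n j =
     (if j = 0 then 0 else if j > 0 then cand_pos p t n (nat j) else - cand_pos p t n (nat (- j)))"

lemma mech_p_zero: "mech_p \<epsilon> n 0 = 1 / (exp \<epsilon> + real (2 * n) - 1)"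
  by (simp add: mech_p_def)

lemma mech_p_fixpoint:
  assumes "p = 1 / (exp \<epsilon> + real (2 * n + 1) - 1)" and "n \<ge> 1"
  shows "mech_p \<epsilon> n p = p"
proof -
  have e: "exp \<epsilon> + 2 * real n > 1" "exp \<epsilon> + 2 * real n - 1 \<noteq> 0" "exp \<epsilon> + 2 * real n \<noteq> 0"
    using assms(2) exp_gt_zero[of \<epsilon>] by linarith+
  show ?thesis
    using e by (simp add: mech_p_def assms(1) divide_simps)
qed

lemma output_prob_on_segment:
  assumes mono: "\<And>k. k \<in> {- int n..<int n} \<Longrightarrow> mech_x \<epsilon> n p0 a k < mech_x \<epsilon> n p0 a (k + 1)"
    and j: "j \<in> {- int n + 1..int n}"
    and y: "y \<in> {mech_x \<epsilon> n p0 a (j - 1)..mech_x \<epsilon> n p0 a j}"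
  shows "output_prob \<epsilon> n p0 a i y = prob_interp \<epsilon> n p0 a i j y"
proof -
  let ?x = "mech_x \<epsilon> n p0 a"
  define S where "S = {k \<in> {- int n + 1..int n}. y \<le> ?x k}"
  define m where "m = Min S"
  have "finite S"
    by (rule finite_subset[of _ "{- int n + 1..int n}"]) (auto simp: S_def)
  moreover have "j \<in> S"
    using j y by (auto simp: S_def)
  ultimately have mS: "m \<in> S" and mj: "m \<le> j"
    unfolding m_def by (auto intro: Min_le intro!: Min_in simp del: Min_in)
  have less: "?x k < ?x l" if "k < l" "- int n \<le> k" "l \<le> int n" for k l
    using that
  proof (induction l rule: int_gr_induct)
    case base
    then show ?case using mono[of k] by simp
  next
    case (step l)
    then show ?case using mono[of l] by force
  qed
  have "?x k < ?x (j - 1)" if "k < j - 1" "k \<in> S" for k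
    using less[of k "j - 1"] that j by (auto simp: S_def)
  then have m_cases: "m = j \<or> m = j - 1"
    using mS mj y by (force simp: S_def)
  have "prob_interp \<epsilon> n p0 a i m y = prob_interp \<epsilon> n p0 a i j y"
  proof (cases "m = j")
    case False
    then have m: "m = j - 1" using m_cases by simp
    then have yx: "y = ?x (j - 1)" using mS y by (auto simp: S_def)
    have "?x (j - 2) < ?x (j - 1)"
      using less[of "j - 2" "j - 1"] m mS by (auto simp: S_def)
    then show ?thesis by (simp add: prob_interp_def m yx)
  qed simp
  then show ?thesis by (simp add: output_prob_def m_def S_def)
qed

end

theory Submission
  imports Defs
begin

text \<open>On an outer segment \<open>[t u, t v]\<close> the noise variance is \<open>2 p \<Sum> a\<^sub>i\<^sup>2\<close> plus a parabola whose peak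
  \<open>(u + v)\<^sup>2 / 4 - t u v\<close> is a convex quadratic form in \<open>(u, v)\<close>, because \<open>0 < t < 1\<close>. Minimizing the
  largest peak is thus a convex problem, and optimality of the sequence that makes all peaks equal
  follows from nonnegative weights of sum 1 under which the weighted gradient of the peaks vanishes.
  The recurrence for \<open>C\<close> says exactly that consecutive peaks agree, so the equalizing sequence and the
  candidate both lie on the line \<open>a\<^sub>n Q + s T\<close>. The condition on the candidate says that it has a larger
  ratio \<open>a\<^sub>1 / a\<^sub>2\<close> and hence a larger parameter \<open>s\<close>. Since the candidate minimizes a convex function of
  \<open>s\<close>, that function decreases at the equalizing sequence, and this makes the weight of the innermost
  segment nonnegative. Pairing stationarity with the direction \<open>T\<close> shows that the weights sum to 1.\<close>

section \<open>Peaks of the variance segments\<close>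

definition seg_peak :: "real \<Rightarrow> real \<Rightarrow> real \<Rightarrow> real" where
  "seg_peak t u v = (u + v)\<^sup>2 / 4 - t * u * v"

text \<open>The derivative of \<open>seg_peak\<close> at \<open>(u, v)\<close> in the direction
  \<open>(u', v')\<close>. It is symmetric in the two pairs, being the bilinear form of the
  quadratic form \<open>2 * seg_peak\<close>.\<close>

definition peak_polar :: "real \<Rightarrow> real \<Rightarrow> real \<Rightarrow> real \<Rightarrow> real \<Rightarrow> real" where
  "peak_polar t u v u' v' = (u / 2 + (1 / 2 - t) * v) * u' + (v / 2 + (1 / 2 - t) * u) * v'"

lemma seg_peak_conv_polar: "seg_peak t u v = peak_polar t u v u v / 2"
  by (simp add: seg_peak_def peak_polar_def power2_eq_square field_simps)

lemma seg_peak_neg: "seg_peak t (- u) (- v) = seg_peak t v u"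
  by (simp add: seg_peak_def power2_eq_square algebra_simps)

lemma seg_peak_nonneg:
  assumes "0 \<le> t" "t \<le> 1"
  shows "0 \<le> seg_peak t u v"
proof -
  \<comment> \<open>The form is diagonal in the coordinates \<open>u + v\<close> and
    \<open>v - u\<close>.\<close>
  have "seg_peak t u v = (1 - t) / 4 * (u + v)\<^sup>2 + t / 4 * (v - u)\<^sup>2"
    by (simp add: seg_peak_def power2_eq_square field_simps)
  also have "\<dots> \<ge> 0"
    using assms by (intro add_nonneg_nonneg mult_nonneg_nonneg) auto
  finally show ?thesis .
qed

text \<open>The second-order Taylor remainder of a quadratic form is the form at the increment, so
  nonnegativity amounts to convexity.\<close>

lemma seg_peak_tangent:
  assumes "0 \<le> t" "t \<le> 1"
  shows "seg_peak t u0 v0 + peak_polar t u0 v0 (u - u0) (v - v0) \<le> seg_peak t u v"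
proof -
  have "seg_peak t u v - seg_peak t u0 v0 - peak_polar t u0 v0 (u - u0) (v - v0)
      = seg_peak t (u - u0) (v - v0)"
    by (simp add: seg_peak_def peak_polar_def power2_eq_square field_simps)
  then show ?thesis
    using seg_peak_nonneg[OF assms, of "u - u0" "v - v0"] by linarith
qed

text \<open>By \<open>clip\<close> the derivative in the first coordinate at \<open>(u0, v0)\<close>
  is at most 0. Lowering \<open>u\<close> to the clipped value can therefore only raise the tangent.
  This covers competitors whose vertices fall outside their segments.\<close>

lemma seg_peak_clipped_tangent:
  assumes "0 \<le> t" "t \<le> 1" and clip: "u0 \<le> (2 * t - 1) * v0"
  shows "seg_peak t u0 v0 + peak_polar t u0 v0 (u - u0) (v - v0)
    \<le> seg_peak t (min u ((2 * t - 1) * v)) v"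
proof -
  define w where "w = min u ((2 * t - 1) * v)"
  have "u0 / 2 + (1 / 2 - t) * v0 \<le> 0"
    using clip by (simp add: algebra_simps)
  then have "(u0 / 2 + (1 / 2 - t) * v0) * (u - w) \<le> 0"
    by (intro mult_nonpos_nonneg) (auto simp: w_def)
  moreover have "peak_polar t u0 v0 (u - u0) (v - v0)
      = peak_polar t u0 v0 (w - u0) (v - v0) + (u0 / 2 + (1 / 2 - t) * v0) * (u - w)"
    by (simp add: peak_polar_def field_simps)
  ultimately show ?thesis
    using seg_peak_tangent[OF assms(1,2), of u0 v0 w v] unfolding w_def by linarith
qed

text \<open>A first integral of the recurrence. For \<open>y = x\<close> it makes all outer peaks of
  a solution equal; in general it makes the derivatives of all outer peaks along \<open>y\<close>
  equal.\<close>

lemma peak_polar_recurrence_const: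
  fixes x y :: "nat \<Rightarrow> real"
  assumes x: "\<And>i. 1 \<le> i \<Longrightarrow> i + 2 \<le> n \<Longrightarrow> x i = (4 * t - 2) * x (i + 1) - x (i + 2)"
    and y: "\<And>i. 1 \<le> i \<Longrightarrow> i + 2 \<le> n \<Longrightarrow> y i = (4 * t - 2) * y (i + 1) - y (i + 2)"
    and "1 \<le> i" "i < n"
  shows "peak_polar t (x i) (x (Suc i)) (y i) (y (Suc i)) = peak_polar t (x 1) (x 2) (y 1) (y 2)"
  using assms(3,4)
proof (induction i rule: dec_induct)
  case base
  then show ?case by (simp add: numeral_2_eq_2)
next
  case (step i)
  have xi: "x i = (4 * t - 2) * x (Suc i) - x (Suc (Suc i))"
    and yi: "y i = (4 * t - 2) * y (Suc i) - y (Suc (Suc i))"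
    using x[of i] y[of i] step by simp_all
  have "peak_polar t (x (Suc i)) (x (Suc (Suc i))) (y (Suc i)) (y (Suc (Suc i)))
      = peak_polar t (x i) (x (Suc i)) (y i) (y (Suc i))"
    unfolding xi yi peak_polar_def by (simp add: field_simps)
  then show ?case using step by simp
qed

section \<open>Optimality from stationary weights\<close>

text \<open>Summation by parts: the equation at \<open>i\<close> is multiplied by
  \<open>d i\<close>. The weight \<open>l 1\<close> belongs to the innermost peak,
  \<open>l (Suc j)\<close> to the segment between \<open>a j\<close> and \<open>a (Suc j)\<close>,
  and \<open>4 * p * a i\<close> is the derivative of the sum of squares times \<open>2 * p\<close>.
  No equation is available at \<open>n\<close>, which is why \<open>d n = 0\<close> is
  required.\<close>

lemma stationary_pairing:
  fixes a l d :: "nat \<Rightarrow> real" and p t \<kappa> :: real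
  assumes stat: "\<And>i. 1 \<le> i \<Longrightarrow> i < n \<Longrightarrow>
      l i * (if i = 1 then 2 * \<kappa> * a 1 else a i / 2 + (1 / 2 - t) * a (i - 1))
      + l (Suc i) * (a i / 2 + (1 / 2 - t) * a (Suc i)) + 4 * p * a i = 0"
    and "1 \<le> n" and dn: "d n = 0"
  shows "l 1 * (2 * \<kappa> * a 1 * d 1)
    + (\<Sum>j=1..<n. l (Suc j) * peak_polar t (a j) (a (Suc j)) (d j) (d (Suc j)))
    + 4 * p * (\<Sum>i=1..<n. a i * d i) = 0"
proof -
  let ?g = "\<lambda>i. if i = 1 then 2 * \<kappa> * a 1 else a i / 2 + (1 / 2 - t) * a (i - 1)"
  \<comment> \<open>The partial sums telescope. What remains at \<open>m\<close> is the derivative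
    of the weighted peak of the segment with right end \<open>a m\<close>, taken in that end
    only.\<close>
  have "m \<le> n \<Longrightarrow> l 1 * (2 * \<kappa> * a 1 * d 1)
      + (\<Sum>j=1..<m. l (Suc j) * peak_polar t (a j) (a (Suc j)) (d j) (d (Suc j)))
      + 4 * p * (\<Sum>i=1..<m. a i * d i) = l m * ?g m * d m" if "1 \<le> m" for m
    using that
  proof (induction m rule: dec_induct)
    case base
    then show ?case by simp
  next
    case (step m)
    have regroup: "x * y * z + u * (v * z + w * r) + 4 * p * (q * z)
        = z * (x * y + u * v + 4 * p * q) + u * w * r" for x y z u v w r q :: real
      by (simp add: algebra_simps)
    have "l 1 * (2 * \<kappa> * a 1 * d 1)
        + (\<Sum>j=1..<Suc m. l (Suc j) * peak_polar t (a j) (a (Suc j)) (d j) (d (Suc j)))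
        + 4 * p * (\<Sum>i=1..<Suc m. a i * d i)
      = l m * ?g m * d m + l (Suc m) * peak_polar t (a m) (a (Suc m)) (d m) (d (Suc m))
        + 4 * p * (a m * d m)"
      using step by (simp add: algebra_simps)
    also have "\<dots> = d m * (l m * ?g m + l (Suc m) * (a m / 2 + (1 / 2 - t) * a (Suc m)) + 4 * p * a m)
        + l (Suc m) * (a (Suc m) / 2 + (1 / 2 - t) * a m) * d (Suc m)"
      unfolding peak_polar_def by (rule regroup)
    also have "\<dots> = l (Suc m) * ?g (Suc m) * d (Suc m)"
      using stat[of m] step by simp
    finally show ?case .
  qed
  from this[of n] show ?thesis using assms(2) dn by simp
qed

text \<open>Weak duality: \<open>W\<close> dominates every clipped peak of \<open>b\<close> on top
  of its sum of squares, hence also their average with weights \<open>l\<close>. Passing to tangents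
  at \<open>a\<close> leaves the common value at \<open>a\<close> plus first-order terms, which
  cancel by stationarity.\<close>

lemma weighted_peak_bound:
  fixes a b l :: "nat \<Rightarrow> real" and p t \<kappa> W :: real
  assumes stat: "\<And>i. 1 \<le> i \<Longrightarrow> i < n \<Longrightarrow>
      l i * (if i = 1 then 2 * \<kappa> * a 1 else a i / 2 + (1 / 2 - t) * a (i - 1))
      + l (Suc i) * (a i / 2 + (1 / 2 - t) * a (Suc i)) + 4 * p * a i = 0"
    and "1 \<le> n" "b n = a n" "0 \<le> p" "0 \<le> \<kappa>" "0 \<le> t" "t \<le> 1"
    and l: "\<And>i. 1 \<le> i \<Longrightarrow> i \<le> n \<Longrightarrow> 0 \<le> l i" "l 1 + (\<Sum>j=1..<n. l (Suc j)) = 1"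
    and equal: "\<And>i. 1 \<le> i \<Longrightarrow> i < n \<Longrightarrow> seg_peak t (a i) (a (Suc i)) = \<kappa> * (a 1)\<^sup>2"
    and clip: "\<And>i. 1 \<le> i \<Longrightarrow> i < n \<Longrightarrow> a i \<le> (2 * t - 1) * a (Suc i)"
    and W1: "2 * p * (\<Sum>i=1..n. (b i)\<^sup>2) + \<kappa> * (b 1)\<^sup>2 \<le> W"
    and W: "\<And>i. 1 \<le> i \<Longrightarrow> i < n \<Longrightarrow>
      2 * p * (\<Sum>i=1..n. (b i)\<^sup>2) + seg_peak t (min (b i) ((2 * t - 1) * b (Suc i))) (b (Suc i)) \<le> W"
  shows "2 * p * (\<Sum>i=1..n. (a i)\<^sup>2) + \<kappa> * (a 1)\<^sup>2 \<le> W"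
proof -
  define d where "d i = b i - a i" for i
  let ?S = "\<lambda>x. 2 * p * (\<Sum>i=1..n. (x i :: real)\<^sup>2)"
  let ?D = "\<lambda>j. peak_polar t (a j) (a (Suc j)) (d j) (d (Suc j))"
  let ?K = "\<kappa> * (a 1)\<^sup>2"
  have dn: "d n = 0" using assms by (simp add: d_def)
  have "0 \<le> \<kappa> * (b 1 - a 1)\<^sup>2"
    using assms by simp
  then have first: "?K + 2 * \<kappa> * a 1 * d 1 \<le> W - ?S b"
    using W1 by (simp add: d_def power2_eq_square algebra_simps)
  have rest: "?K + ?D j \<le> W - ?S b" if "1 \<le> j" "j < n" for j
    using seg_peak_clipped_tangent[OF assms(6,7) clip[OF that], of "b j" "b (Suc j)"]
      W[OF that] equal[OF that] by (simp add: d_def)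
  have "?K + l 1 * (2 * \<kappa> * a 1 * d 1) + (\<Sum>j=1..<n. l (Suc j) * ?D j)
      = (l 1 + (\<Sum>j=1..<n. l (Suc j))) * ?K + l 1 * (2 * \<kappa> * a 1 * d 1) + (\<Sum>j=1..<n. l (Suc j) * ?D j)"
    using l(2) by simp
  also have "\<dots> = l 1 * (?K + 2 * \<kappa> * a 1 * d 1) + (\<Sum>j=1..<n. l (Suc j) * (?K + ?D j))"
    by (simp add: distrib_left distrib_right sum.distrib sum_distrib_right)
  also have "\<dots> \<le> l 1 * (W - ?S b) + (\<Sum>j=1..<n. l (Suc j) * (W - ?S b))"
    by (intro add_mono sum_mono mult_left_mono first rest l) (use assms in auto)
  also have "\<dots> = (l 1 + (\<Sum>j=1..<n. l (Suc j))) * (W - ?S b)"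
    by (simp only: distrib_right sum_distrib_right)
  also have "\<dots> = W - ?S b"
    using l(2) by simp
  finally have peaks: "?K + l 1 * (2 * \<kappa> * a 1 * d 1) + (\<Sum>j=1..<n. l (Suc j) * ?D j) \<le> W - ?S b" .
  \<comment> \<open>The sum of squares is bounded below by its own tangent at
    \<open>a\<close>.\<close>
  have "(\<Sum>i=1..n. (a i)\<^sup>2 + 2 * (a i * d i)) \<le> (\<Sum>i=1..n. (b i)\<^sup>2)"
  proof (rule sum_mono)
    fix i
    have "0 \<le> (b i - a i)\<^sup>2" by simp
    then show "(a i)\<^sup>2 + 2 * (a i * d i) \<le> (b i)\<^sup>2"
      by (simp add: d_def power2_eq_square algebra_simps)
  qed
  moreover have "(\<Sum>i=1..n. a i * d i) = (\<Sum>i=1..<n. a i * d i)"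
  proof (rule sum.mono_neutral_right)
    show "\<forall>i\<in>{1..n} - {1..<n}. a i * d i = 0"
    proof
      fix i assume "i \<in> {1..n} - {1..<n}"
      then have "i = n" by auto
      then show "a i * d i = 0" using dn by simp
    qed
  qed auto
  ultimately have "(\<Sum>i=1..n. (a i)\<^sup>2) + 2 * (\<Sum>i=1..<n. a i * d i) \<le> (\<Sum>i=1..n. (b i)\<^sup>2)"
    by (simp only: sum.distrib flip: sum_distrib_left)
  then have "2 * p * ((\<Sum>i=1..n. (a i)\<^sup>2) + 2 * (\<Sum>i=1..<n. a i * d i)) \<le> ?S b"
    using assms by (intro mult_left_mono) auto
  then have "?S a + 4 * p * (\<Sum>i=1..<n. a i * d i) \<le> ?S b"
    by (simp add: algebra_simps)
  moreover have "l 1 * (2 * \<kappa> * a 1 * d 1) + (\<Sum>j=1..<n. l (Suc j) * ?D j)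
      + 4 * p * (\<Sum>i=1..<n. a i * d i) = 0"
    by (rule stationary_pairing[where l = l and a = a and d = d and n = n and t = t and p = p
          and \<kappa> = \<kappa>, OF _ assms(2) dn]) (rule stat)
  moreover have "k + x + y \<le> w - sb \<Longrightarrow> sa + z \<le> sb \<Longrightarrow> x + y + z = 0 \<Longrightarrow> sa + k \<le> w"
    for k x y z w sa sb :: real by linarith
  ultimately show ?thesis
    using peaks by blast
qed

text \<open>Stationarity determines \<open>l (Suc i)\<close> from \<open>l i\<close>, so only
  \<open>l 1\<close> is free. The clipping bounds give the coefficients the signs that propagate
  nonnegativity upwards from \<open>l 1\<close>, and \<open>slope\<close> makes \<open>l 1\<close>
  itself nonnegative.\<close>

lemma ex_stationary_weights:
  fixes a T :: "nat \<Rightarrow> real" and p t \<kappa> :: real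
  assumes "2 \<le> n" "0 \<le> p" "0 < \<kappa>" "t < 1"
    and apos: "\<And>i. 1 \<le> i \<Longrightarrow> i \<le> n \<Longrightarrow> 0 < a i"
    and clip: "\<And>i. 1 \<le> i \<Longrightarrow> i < n \<Longrightarrow> a i < (2 * t - 1) * a (Suc i)"
    and arec: "\<And>i. 1 \<le> i \<Longrightarrow> i + 2 \<le> n \<Longrightarrow> a i = (4 * t - 2) * a (i + 1) - a (i + 2)"
    and Trec: "\<And>i. 1 \<le> i \<Longrightarrow> i + 2 \<le> n \<Longrightarrow> T i = (4 * t - 2) * T (i + 1) - T (i + 2)"
    and T: "T n = 0" "T (n - 1) = 1" "0 < T 1"
    and slope: "a (n - 1) / 2 + (1 / 2 - t) * a n + 4 * p * (\<Sum>i=1..<n. a i * T i) \<le> 0"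
  obtains l :: "nat \<Rightarrow> real"
    where "\<And>i. 1 \<le> i \<Longrightarrow> i \<le> n \<Longrightarrow> 0 \<le> l i" "l 1 + (\<Sum>j=1..<n. l (Suc j)) = 1"
      "\<And>i. 1 \<le> i \<Longrightarrow> i < n \<Longrightarrow>
        l i * (if i = 1 then 2 * \<kappa> * a 1 else a i / 2 + (1 / 2 - t) * a (i - 1))
        + l (Suc i) * (a i / 2 + (1 / 2 - t) * a (Suc i)) + 4 * p * a i = 0"
proof -
  define \<phi> where "\<phi> = a (n - 1) / 2 + (1 / 2 - t) * a n"
  define \<sigma> where "\<sigma> = 4 * p * (\<Sum>i=1..<n. a i * T i)"
  \<comment> \<open>\<open>g i\<close> is the derivative of the peak with right end
    \<open>a i\<close> in that end; \<open>h i\<close> is minus the derivative of the next peak in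
    its left end \<open>a i\<close>.\<close>
  define g where "g i = (if i = 1 then 2 * \<kappa> * a 1 else a i / 2 + (1 / 2 - t) * a (i - 1))" for i
  define h where "h i = (t - 1 / 2) * a (Suc i) - a i / 2" for i
  \<comment> \<open>The solution of \<open>l1 * (2 * \<kappa> * a 1 * T 1) + (1 - l1) * \<phi> +
    \<sigma> = 0\<close>, which is stationarity paired with \<open>T\<close> under a total weight of
    1.\<close>
  define l1 where "l1 = - (\<phi> + \<sigma>) / (2 * \<kappa> * a 1 * T 1 - \<phi>)"
  \<comment> \<open>The value 0 at index 0 is a placeholder; the weights start at index 1.\<close>
  define l where "l = rec_nat 0 (\<lambda>i x. if i = 0 then l1 else (4 * p * a i + x * g i) / h i)"
  have l_1: "l 1 = l1" by (simp add: l_def)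
  have l_Suc: "l (Suc i) = (4 * p * a i + l i * g i) / h i" if "1 \<le> i" for i
    using that by (simp add: l_def)
  have h: "0 < h i" if "1 \<le> i" "i < n" for i
    using clip[OF that] by (simp add: h_def algebra_simps)
  have g: "0 < g i" if i: "1 \<le> i" "i < n" for i
  proof (cases "i = 1")
    case True
    then show ?thesis using assms apos[of 1] by (simp add: g_def)
  next
    case False
    \<comment> \<open>Clipping at \<open>i - 1\<close> together with \<open>t < 1\<close> puts
      \<open>2 * t - 1\<close> strictly between 0 and 1.\<close>
    then have pos: "0 < a (i - 1)" "0 < a i" "a (i - 1) < (2 * t - 1) * a i"
      using apos[of "i - 1"] apos[of i] clip[of "i - 1"] i by auto
    then have "0 < (2 * t - 1) * a i" by linarith
    then have "0 < 2 * t - 1" using pos(2) by (simp add: zero_less_mult_iff)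
    then have "(2 * t - 1) * a (i - 1) \<le> 1 * a (i - 1)" "(2 * t - 1) * a i \<le> 1 * a i"
      using pos \<open>t < 1\<close> by (intro mult_right_mono; simp)+
    then have "(2 * t - 1) * a (i - 1) < a i" using pos by linarith
    then show ?thesis using False by (simp add: g_def algebra_simps)
  qed
  have \<phi>_neg: "\<phi> < 0"
  proof -
    have "1 \<le> n - 1" "n - 1 < n" "Suc (n - 1) = n" using assms(1) by auto
    then have "a (n - 1) < (2 * t - 1) * a n" using clip[of "n - 1"] by simp
    then show ?thesis by (simp add: \<phi>_def algebra_simps)
  qed
  have den: "0 < 2 * \<kappa> * a 1 * T 1 - \<phi>"
  proof -
    have "0 < 2 * \<kappa> * a 1 * T 1" using assms apos[of 1] by simp
    then show ?thesis using \<phi>_neg by linarith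
  qed
  have "0 \<le> l1"
    unfolding l1_def using slope den by (intro divide_nonneg_pos) (auto simp: \<phi>_def \<sigma>_def)
  have l_nonneg: "i \<le> n \<Longrightarrow> 0 \<le> l i" if "1 \<le> i" for i
    using that
  proof (induction i rule: dec_induct)
    case (step i)
    then have "0 \<le> l i" "0 < g i" "0 < h i" "0 < a i" using g h apos by auto
    then show ?case using l_Suc step \<open>0 \<le> p\<close> by simp
  qed (simp add: l_1[unfolded One_nat_def] \<open>0 \<le> l1\<close>)
  have stat: "l i * g i + l (Suc i) * (a i / 2 + (1 / 2 - t) * a (Suc i)) + 4 * p * a i = 0"
    if "1 \<le> i" "i < n" for i
  proof -
    have "l (Suc i) * h i = 4 * p * a i + l i * g i"
      using l_Suc h that by (simp add: less_imp_neq[symmetric])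
    then show ?thesis unfolding h_def by (simp add: algebra_simps)
  qed
  \<comment> \<open>The form is constant along the recurrence; at the top the pair taken from
    \<open>T\<close> is \<open>(1, 0)\<close>, which gives \<open>\<phi>\<close>.\<close>
  have polar: "peak_polar t (a j) (a (Suc j)) (T j) (T (Suc j)) = \<phi>" if "1 \<le> j" "j < n" for j
  proof -
    have "peak_polar t (a (n - 1)) (a (Suc (n - 1))) (T (n - 1)) (T (Suc (n - 1))) = \<phi>"
      using assms(1) T by (simp add: peak_polar_def \<phi>_def)
    moreover have "1 \<le> n - 1" "n - 1 < n" using assms(1) by auto
    ultimately show ?thesis
      using peak_polar_recurrence_const[of n a t T] arec Trec that by metis
  qed
  have "l 1 * (2 * \<kappa> * a 1 * T 1)
      + (\<Sum>j=1..<n. l (Suc j) * peak_polar t (a j) (a (Suc j)) (T j) (T (Suc j))) + \<sigma> = 0"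
    unfolding \<sigma>_def
    by (rule stationary_pairing[where l = l and a = a and d = T and n = n and t = t and p = p
          and \<kappa> = \<kappa>])
      (use assms stat in \<open>auto simp: g_def\<close>)
  moreover have "(\<Sum>j=1..<n. l (Suc j) * peak_polar t (a j) (a (Suc j)) (T j) (T (Suc j)))
      = (\<Sum>j=1..<n. l (Suc j)) * \<phi>"
    by (simp add: polar sum_distrib_right)
  moreover have "l 1 * (2 * \<kappa> * a 1 * T 1 - \<phi>) = - (\<phi> + \<sigma>)"
    unfolding l_1 l1_def using den by simp
  ultimately have "(l 1 + (\<Sum>j=1..<n. l (Suc j)) - 1) * \<phi> = 0"
    by (simp add: algebra_simps)
  then have "l 1 + (\<Sum>j=1..<n. l (Suc j)) = 1"
    using \<phi>_neg by simp
  then show ?thesis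
    using that[OF l_nonneg _ stat[unfolded g_def]] by blast
qed

section \<open>The noise variance of the mechanism\<close>

lemma sum_int_symmetric:
  fixes f :: "int \<Rightarrow> real"
  shows "(\<Sum>i\<in>{- int n..int n}. f i) = f 0 + (\<Sum>k=1..n. f (int k) + f (- int k))"
proof (induction n)
  case (Suc n)
  have "{- int (Suc n)..int (Suc n)} = insert (int (Suc n)) (insert (- int (Suc n)) {- int n..int n})"
    by auto
  then have "(\<Sum>i\<in>{- int (Suc n)..int (Suc n)}. f i)
      = f (int (Suc n)) + (f (- int (Suc n)) + (\<Sum>i\<in>{- int n..int n}. f i))"
    by (simp del: of_nat_Suc)
  then show ?case using Suc by simp
qed simp

lemma sum_int_positive:
  fixes f :: "int \<Rightarrow> real"
  shows "(\<Sum>i\<in>{1..int n}. f i) = (\<Sum>k=1..n. f (int k))"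
  by (rule sum.reindex_bij_witness[of _ int nat]) auto

locale structured_mechanism =
  fixes \<epsilon> p t p0 :: real and n N :: nat
  assumes eps: "\<epsilon> > 0" and n_ge: "n \<ge> 2" and N: "N \<in> {2 * n, 2 * n + 1}"
    and p_eq: "p = 1 / (exp \<epsilon> + real N - 1)" and t_eq: "t = (exp \<epsilon> - 1) * p"
    and p0_eq: "p0 = (if N = 2 * n then 0 else p)"
begin

text \<open>\<open>kappa * (b 1)^2\<close> is the height of the innermost peak above
  \<open>energy b\<close>: for even \<open>N\<close> that of \<open>t * (b 1)^2 - y^2\<close> at 0,
  for odd \<open>N\<close> that of \<open>\<bar>y\<bar> * b 1 - y^2\<close> at
  \<open>\<bar>y\<bar> = b 1 / 2\<close>.\<close>

definition kappa :: real where
  "kappa = (if N = 2 * n then t else 1 / 4)"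

definition energy :: "(int \<Rightarrow> real) \<Rightarrow> real" where
  "energy b = 2 * p * (\<Sum>k=1..n. (b (int k))\<^sup>2)"

text \<open>Chosen so that the second moment at the node \<open>j\<close> is
  \<open>energy b + t * excess b j\<close>. The cases at 0 differ because \<open>mech_pstar\<close>
  is \<open>p + t / 2\<close> for even \<open>N\<close> and \<open>p\<close> for odd
  \<open>N\<close>.\<close>

definition excess :: "(int \<Rightarrow> real) \<Rightarrow> int \<Rightarrow> real" where
  "excess b j = (if j \<noteq> 0 then (b j)\<^sup>2 else if N = 2 * n then (b 1)\<^sup>2 else 0)"

lemma p_pos: "0 < p" and t_pos: "0 < t" and t_less_1: "t < 1"
proof -
  have e: "1 < exp \<epsilon>" "4 \<le> real N" using eps N n_ge by auto
  then have pos: "0 < exp \<epsilon> + real N - 1" by linarith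
  then show p: "0 < p" by (simp add: p_eq)
  then show "0 < t" using e by (simp add: t_eq)
  have "p * (exp \<epsilon> + real N - 1) = 1" using pos by (simp add: p_eq)
  moreover have "0 < p * real N" using p e by simp
  ultimately show "t < 1" by (simp add: t_eq algebra_simps)
qed

lemma kappa_pos: "0 < kappa"
  using t_pos by (simp add: kappa_def)

lemma mech_p_eq [simp]: "mech_p \<epsilon> n p0 = p"
proof (cases "N = 2 * n")
  case True
  then show ?thesis using mech_p_zero[of \<epsilon> n] by (simp add: p0_eq p_eq)
next
  case False
  then have "N = 2 * n + 1" using N by auto
  then show ?thesis using mech_p_fixpoint[of p \<epsilon> n] n_ge by (simp add: p0_eq p_eq)
qed

lemma mech_t_eq [simp]: "mech_t \<epsilon> n p0 = t"
  by (simp add: mech_t_def t_eq)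

lemma mech_pstar_eq: "mech_pstar \<epsilon> n p0 = (if N = 2 * n then p + t / 2 else p)"
proof -
  have "exp \<epsilon> + real N - 1 \<noteq> 0" using p_pos by (auto simp: p_eq)
  then have "1 = (exp \<epsilon> + real N - 1) * p" by (simp add: p_eq)
  then show ?thesis
    using N unfolding mech_pstar_def mech_p_eq by (auto simp: p0_eq t_eq field_simps)
qed

text \<open>Outside row 0, which \<open>f 0 = 0\<close> suppresses, column \<open>j\<close> of
  \<open>mech_P\<close> is \<open>p\<close> throughout, plus \<open>t\<close> on the
  diagonal.\<close>

lemma weighted_sum:
  assumes "f 0 = 0" "j \<in> {- int n..int n}" "j \<noteq> 0"
  shows "(\<Sum>i\<in>{- int n..int n}. f i * mech_P \<epsilon> n p0 i j) = p * (\<Sum>i\<in>{- int n..int n}. f i) + t * f j"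
proof -
  have "(\<Sum>i\<in>{- int n..int n}. f i * mech_P \<epsilon> n p0 i j)
      = (\<Sum>i\<in>{- int n..int n}. p * f i + (if i = j then t * f j else 0))"
    using assms by (intro sum.cong) (auto simp: mech_P_def t_eq algebra_simps)
  also have "\<dots> = p * (\<Sum>i\<in>{- int n..int n}. f i) + t * f j"
    using assms by (simp add: sum.distrib sum_distrib_left)
  finally show ?thesis .
qed

lemma weighted_sum_0:
  assumes "f 0 = 0"
  shows "(\<Sum>i\<in>{- int n..int n}. f i * mech_P \<epsilon> n p0 i 0)
    = p * (\<Sum>i\<in>{- int n..int n}. f i) + (mech_pstar \<epsilon> n p0 - p) * (f 1 + f (- 1))"
proof -
  let ?q = "mech_pstar \<epsilon> n p0 - p"
  have "(\<Sum>i\<in>{- int n..int n}. f i * mech_P \<epsilon> n p0 i 0)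
      = (\<Sum>i\<in>{- int n..int n}. p * f i + ((if i = 1 then ?q * f 1 else 0)
          + (if i = - 1 then ?q * f (- 1) else 0)))"
    using assms by (intro sum.cong) (auto simp: mech_P_def abs_if algebra_simps)
  also have "\<dots> = p * (\<Sum>i\<in>{- int n..int n}. f i) + ?q * (f 1 + f (- 1))"
    using n_ge by (simp add: sum.distrib sum_distrib_left algebra_simps)
  finally show ?thesis .
qed

lemma admissibleD:
  assumes "admissible \<epsilon> n p0 b"
  shows "b 0 = 0" "b (int n) = 1 / t" "i \<in> {- int n..int n} \<Longrightarrow> b (- i) = - b i"
  using assms by (auto simp: admissible_def)

lemma admissible_less:
  assumes "admissible \<epsilon> n p0 b" "k < l" "- int n \<le> k" "l \<le> int n"
  shows "b k < b l"
  using assms(2-4)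
proof (induction l rule: int_gr_induct)
  case base
  then show ?case using assms(1) by (auto simp: admissible_def)
next
  case (step l)
  have "b l < b (l + 1)" using assms(1) step by (auto simp: admissible_def)
  then show ?case using step by auto
qed

lemma admissible_le:
  assumes "admissible \<epsilon> n p0 b" "k \<le> l" "- int n \<le> k" "l \<le> int n"
  shows "b k \<le> b l"
  using admissible_less[OF assms(1), of k l] assms by (cases "k = l") auto

lemma sum_admissible:
  assumes "admissible \<epsilon> n p0 b"
  shows "(\<Sum>i\<in>{- int n..int n}. b i) = 0" "p * (\<Sum>i\<in>{- int n..int n}. (b i)\<^sup>2) = energy b"
proof -
  have odd: "b (- int k) = - b (int k)" if "k \<in> {1..n}" for k
    using admissibleD(3)[OF assms, of "int k"] that by auto
  show "(\<Sum>i\<in>{- int n..int n}. b i) = 0"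
    unfolding sum_int_symmetric using odd admissibleD(1)[OF assms] by simp
  have "(\<Sum>i\<in>{- int n..int n}. (b i)\<^sup>2) = (\<Sum>k=1..n. 2 * (b (int k))\<^sup>2)"
    unfolding sum_int_symmetric using odd admissibleD(1)[OF assms] by simp
  then show "p * (\<Sum>i\<in>{- int n..int n}. (b i)\<^sup>2) = energy b"
    by (simp add: energy_def flip: sum_distrib_left)
qed

lemma mech_x_eq:
  assumes "admissible \<epsilon> n p0 b" "j \<in> {- int n..int n}"
  shows "mech_x \<epsilon> n p0 b j = t * b j"
proof (cases "j = 0")
  case True
  then show ?thesis
    using weighted_sum_0[of b] sum_admissible[OF assms(1)] admissibleD[OF assms(1)] n_ge
    by (simp add: mech_x_def)
next
  case False
  then show ?thesis
    using weighted_sum[of b j] sum_admissible[OF assms(1)] admissibleD[OF assms(1)] assms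
    by (simp add: mech_x_def)
qed

lemma second_moment:
  assumes "admissible \<epsilon> n p0 b" "j \<in> {- int n..int n}"
  shows "(\<Sum>i\<in>{- int n..int n}. (b i)\<^sup>2 * mech_P \<epsilon> n p0 i j) = energy b + t * excess b j"
proof (cases "j = 0")
  case True
  have "b (- 1) = - b 1" using admissibleD(3)[OF assms(1), of 1] n_ge by simp
  then show ?thesis
    using True weighted_sum_0[of "\<lambda>i. (b i)\<^sup>2"] sum_admissible[OF assms(1)] admissibleD(1)[OF assms(1)]
    by (simp add: excess_def mech_pstar_eq)
next
  case False
  then show ?thesis
    using weighted_sum[of "\<lambda>i. (b i)\<^sup>2" j] sum_admissible[OF assms(1)] admissibleD(1)[OF assms(1)] assms
    by (simp add: excess_def)
qed

text \<open>Affine interpolation commutes with the sum over outputs, so only the second moments at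
  the two nodes enter.\<close>

lemma noise_var_interpolation:
  assumes b: "admissible \<epsilon> n p0 b" and j: "j \<in> {- int n + 1..int n}"
    and y: "y \<in> {t * b (j - 1)..t * b j}"
  shows "noise_var \<epsilon> n p0 b y = energy b + t * excess b (j - 1)
    + (y - t * b (j - 1)) / (b j - b (j - 1)) * (excess b j - excess b (j - 1)) - y\<^sup>2"
proof -
  have out: "output_prob \<epsilon> n p0 b i y = prob_interp \<epsilon> n p0 b i j y" for i
  proof (rule output_prob_on_segment)
    fix k assume "k \<in> {- int n..<int n}"
    then show "mech_x \<epsilon> n p0 b k < mech_x \<epsilon> n p0 b (k + 1)"
      using b t_pos admissible_less[OF b, of k "k + 1"] by (simp add: mech_x_eq)
  qed (use j y b in \<open>auto simp: mech_x_eq\<close>)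
  define w where "w = (y - t * b (j - 1)) / (t * b j - t * b (j - 1))"
  have interp: "prob_interp \<epsilon> n p0 b i j y
      = mech_P \<epsilon> n p0 i (j - 1) + w * (mech_P \<epsilon> n p0 i j - mech_P \<epsilon> n p0 i (j - 1))" for i
    using j b by (simp add: prob_interp_def w_def mech_x_eq)
  have "noise_var \<epsilon> n p0 b y = (\<Sum>i\<in>{- int n..int n}. (b i)\<^sup>2 * mech_P \<epsilon> n p0 i (j - 1))
      + w * ((\<Sum>i\<in>{- int n..int n}. (b i)\<^sup>2 * mech_P \<epsilon> n p0 i j)
        - (\<Sum>i\<in>{- int n..int n}. (b i)\<^sup>2 * mech_P \<epsilon> n p0 i (j - 1))) - y\<^sup>2"
    unfolding noise_var_def out interp
    by (simp add: algebra_simps sum.distrib sum_subtractf sum_distrib_left)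
  also have "\<dots> = energy b + t * excess b (j - 1) + w * (t * excess b j - t * excess b (j - 1)) - y\<^sup>2"
    using j b by (simp add: second_moment)
  also have "w * (t * excess b j - t * excess b (j - 1))
      = (y - t * b (j - 1)) / (b j - b (j - 1)) * (excess b j - excess b (j - 1))"
    using t_pos admissible_less[OF b, of "j - 1" j] j
    by (simp add: w_def right_diff_distrib[symmetric])
  finally show ?thesis by simp
qed

text \<open>On a segment without end point 0 both excesses are squares, and the chord of the square
  function has the sum of its end points as slope.\<close>

lemma noise_var_outer:
  assumes b: "admissible \<epsilon> n p0 b" and j: "j \<in> {- int n + 1..int n}" "j \<notin> {0, 1}"
    and y: "y \<in> {t * b (j - 1)..t * b j}"
  shows "noise_var \<epsilon> n p0 b y
    = energy b + (b (j - 1) + b j) * y - t * b (j - 1) * b j - y\<^sup>2"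
proof -
  have ne: "b j - b (j - 1) \<noteq> 0"
    using admissible_less[OF b, of "j - 1" j] j by simp
  have "excess b j - excess b (j - 1) = (b j - b (j - 1)) * (b (j - 1) + b j)"
    using j by (simp add: excess_def power2_eq_square algebra_simps)
  then have quot: "(y - t * b (j - 1)) / (b j - b (j - 1)) * (excess b j - excess b (j - 1))
      = (y - t * b (j - 1)) * (b (j - 1) + b j)"
    using ne by simp
  then show ?thesis
    unfolding noise_var_interpolation[OF b j(1) y] quot
    using j by (simp add: excess_def power2_eq_square algebra_simps)
qed

lemma noise_var_inner:
  assumes b: "admissible \<epsilon> n p0 b" and y: "\<bar>y\<bar> \<le> t * b 1"
  shows "noise_var \<epsilon> n p0 b y
    = energy b + (if N = 2 * n then t * (b 1)\<^sup>2 else \<bar>y\<bar> * b 1) - y\<^sup>2"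
proof -
  have b1: "b (- 1) = - b 1" "b 0 = 0" "0 < b 1"
    using admissibleD[OF b] admissible_less[OF b, of 0 1] n_ge by auto
  show ?thesis
  proof (cases "0 \<le> y")
    case True
    have "y \<in> {t * b (1 - 1)..t * b 1}" using y True b1 by simp
    from noise_var_interpolation[OF b _ this] show ?thesis
      using True b1 n_ge by (simp add: excess_def power2_eq_square)
  next
    case False
    have "y \<in> {t * b (0 - 1)..t * b 0}" using y False b1 by simp
    from noise_var_interpolation[OF b _ this]
    have "noise_var \<epsilon> n p0 b y = energy b + t * (b 1)\<^sup>2
        + (y + t * b 1) / b 1 * ((if N = 2 * n then (b 1)\<^sup>2 else 0) - (b 1)\<^sup>2) - y\<^sup>2"
      using b1 n_ge by (simp add: excess_def)
    also have "(y + t * b 1) / b 1 * ((if N = 2 * n then (b 1)\<^sup>2 else 0) - (b 1)\<^sup>2)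
        = (if N = 2 * n then 0 else - ((y + t * b 1) * b 1))"
      using b1 by (simp add: power2_eq_square)
    finally show ?thesis
      using False by (simp add: power2_eq_square algebra_simps)
  qed
qed

lemma ex_segment:
  assumes b: "admissible \<epsilon> n p0 b" and y: "y \<in> {-1..1}"
  obtains j where "j \<in> {- int n + 1..int n}" "y \<in> {t * b (j - 1)..t * b j}"
proof -
  have bn: "t * b (int n) = 1" "t * b (- int n) = - 1"
    using admissibleD(2)[OF b] admissibleD(3)[OF b, of "int n"] t_pos by simp_all
  define S where "S = {j \<in> {- int n + 1..int n}. y \<le> t * b j}"
  have S: "finite S"
    unfolding S_def by (rule finite_subset[of _ "{- int n + 1..int n}"]) auto
  have nS: "int n \<in> S"
    using bn y n_ge by (auto simp: S_def)
  define m where "m = Min S"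
  have m: "m \<in> S" using S nS unfolding m_def by (metis Min_in empty_iff)
  have "t * b (m - 1) \<le> y"
  proof (cases "m = - int n + 1")
    case True
    then show ?thesis using bn y by simp
  next
    case False
    have "m - 1 \<notin> S" using Min_le[OF S, of "m - 1"] by (auto simp: m_def)
    then show ?thesis using False m by (auto simp: S_def)
  qed
  then show ?thesis using that[of m] m by (auto simp: S_def)
qed

lemma noise_var_le:
  assumes b: "admissible \<epsilon> n p0 b" and y: "y \<in> {-1..1}"
    and K: "kappa * (b 1)\<^sup>2 \<le> K"
      "\<And>i. 1 \<le> i \<Longrightarrow> i < n \<Longrightarrow> seg_peak t (b (int i)) (b (int (Suc i))) \<le> K"
  shows "noise_var \<epsilon> n p0 b y \<le> energy b + K"
proof -
  obtain j where j: "j \<in> {- int n + 1..int n}" "y \<in> {t * b (j - 1)..t * b j}"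
    using ex_segment[OF b y] .
  show ?thesis
  proof (cases "j \<in> {0, 1}")
    case True
    have b1: "b (- 1) = - b 1" "b 0 = 0" "0 < b 1"
      using admissibleD[OF b] admissible_less[OF b, of 0 1] n_ge by auto
    have "0 < t * b 1" using t_pos b1 by simp
    then have "\<bar>y\<bar> \<le> t * b 1" using True j b1 by auto
    note v = noise_var_inner[OF b this]
    have "0 \<le> (\<bar>y\<bar> - b 1 / 2)\<^sup>2" by simp
    then have "\<bar>y\<bar> * b 1 - y\<^sup>2 \<le> 1 / 4 * (b 1)\<^sup>2"
      by (simp add: power2_diff power_divide algebra_simps)
    moreover have "0 \<le> y\<^sup>2" by simp
    ultimately have "(if N = 2 * n then t * (b 1)\<^sup>2 else \<bar>y\<bar> * b 1) - y\<^sup>2 \<le> kappa * (b 1)\<^sup>2"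
      by (simp add: kappa_def)
    then show ?thesis using K(1) v by linarith
  next
    case False
    \<comment> \<open>Completing the square bounds the parabola by its vertex value, whether or not
      the vertex lies in the segment.\<close>
    have "0 \<le> (y - (b (j - 1) + b j) / 2)\<^sup>2" by simp
    then have le: "noise_var \<epsilon> n p0 b y \<le> energy b + seg_peak t (b (j - 1)) (b j)"
      unfolding noise_var_outer[OF b j(1) False j(2)] seg_peak_def
      by (simp add: power2_eq_square field_simps)
    have "seg_peak t (b (j - 1)) (b j) \<le> K"
    proof (cases "j > 0")
      case True
      then show ?thesis using K(2)[of "nat (j - 1)"] False j by auto
    next
      case neg: False
      \<comment> \<open>Oddness reflects a segment on the left of 0 to the one with index
        \<open>1 - j\<close> on the right.\<close>
      have "seg_peak t (b (j - 1)) (b j) = seg_peak t (- b (1 - j)) (- b (- j))"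
        using admissibleD(3)[OF b, of "1 - j"] admissibleD(3)[OF b, of "- j"] j neg by simp
      also have "\<dots> = seg_peak t (b (- j)) (b (1 - j))" by (rule seg_peak_neg)
      also have "\<dots> \<le> K" using K(2)[of "nat (- j)"] False neg j by (auto simp: add.commute)
      finally show ?thesis .
    qed
    then show ?thesis using le by simp
  qed
qed

lemma worst_var_le:
  assumes "admissible \<epsilon> n p0 b" "kappa * (b 1)\<^sup>2 \<le> K"
    "\<And>i. 1 \<le> i \<Longrightarrow> i < n \<Longrightarrow> seg_peak t (b (int i)) (b (int (Suc i))) \<le> K"
  shows "worst_var \<epsilon> n p0 b \<le> energy b + K"
  unfolding worst_var_def
proof (rule cSUP_least)
  fix y :: real assume "y \<in> {-1..1}"
  then show "noise_var \<epsilon> n p0 b y \<le> energy b + K"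
    by (rule noise_var_le[OF assms(1) _ assms(2,3)])
qed simp

text \<open>The supremum is an upper bound only once the variance is known to be bounded; the
  maximum of the finitely many peaks supplies the bound.\<close>

lemma noise_var_le_worst_var:
  assumes b: "admissible \<epsilon> n p0 b" and y: "y \<in> {-1..1}"
  shows "noise_var \<epsilon> n p0 b y \<le> worst_var \<epsilon> n p0 b"
proof -
  define K where "K = Max (insert (kappa * (b 1)\<^sup>2)
    ((\<lambda>i. seg_peak t (b (int i)) (b (int (Suc i)))) ` {1..<n}))"
  have "kappa * (b 1)\<^sup>2 \<le> K" unfolding K_def by (intro Max_ge) auto
  moreover have "seg_peak t (b (int i)) (b (int (Suc i))) \<le> K" if "1 \<le> i" "i < n" for i
    unfolding K_def using that by (intro Max_ge) auto
  ultimately have "bdd_above (noise_var \<epsilon> n p0 b ` {-1..1})"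
    by (intro bdd_aboveI2[where M = "energy b + K"] noise_var_le[OF b])
  then show ?thesis unfolding worst_var_def using y by (intro cSUP_upper)
qed

lemma segment_in_range:
  assumes b: "admissible \<epsilon> n p0 b" and "0 \<le> j" "j \<le> int n" "0 \<le> y" "y \<le> t * b j"
  shows "y \<in> {-1..1}"
proof -
  have "t * b j \<le> t * b (int n)"
    using admissible_le[OF b, of j "int n"] assms t_pos by (intro mult_left_mono) auto
  then show ?thesis using assms admissibleD(2)[OF b] t_pos by simp
qed

text \<open>The assumption \<open>1 / 2 \<le> t\<close> places the vertex \<open>b 1 / 2\<close> of
  the odd case within the segment, which ends at \<open>t * b 1\<close>.\<close>

lemma worst_var_ge_inner:
  assumes b: "admissible \<epsilon> n p0 b" and t: "1 / 2 \<le> t"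
  shows "energy b + kappa * (b 1)\<^sup>2 \<le> worst_var \<epsilon> n p0 b"
proof -
  have b1: "0 < b 1" using admissibleD[OF b] admissible_less[OF b, of 0 1] n_ge by auto
  define y where "y = (if N = 2 * n then 0 else b 1 / 2)"
  have "b 1 * (1 / 2) \<le> b 1 * t" using b1 t by (intro mult_left_mono) auto
  then have y: "0 \<le> y" "y \<le> t * b 1" using b1 t_pos by (auto simp: y_def mult.commute)
  have "energy b + kappa * (b 1)\<^sup>2 = noise_var \<epsilon> n p0 b y"
    using noise_var_inner[OF b, of y] y b1
    by (simp add: y_def kappa_def power2_eq_square split: if_splits)
  also have "\<dots> \<le> worst_var \<epsilon> n p0 b"
    using noise_var_le_worst_var[OF b] segment_in_range[OF b, of 1 y] y n_ge by simp
  finally show ?thesis .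
qed

text \<open>If the vertex of the parabola lies to the right of its segment, the maximum over the segment is
  at the right end point; this is the peak for the left neighbour lowered to \<open>(2 t - 1) v\<close>.\<close>

lemma worst_var_ge_outer:
  assumes b: "admissible \<epsilon> n p0 b" and i: "1 \<le> i" "i < n"
  shows "energy b + seg_peak t (min (b (int i)) ((2 * t - 1) * b (int (Suc i)))) (b (int (Suc i)))
    \<le> worst_var \<epsilon> n p0 b"
proof -
  define u v where "u = b (int i)" and "v = b (int (Suc i))"
  define y where "y = (min u ((2 * t - 1) * v) + v) / 2"
  have uv: "0 < u" "u < v"
    using admissibleD(1)[OF b] admissible_less[OF b, of 0 "int i"]
      admissible_less[OF b, of "int i" "int (Suc i)"] i by (auto simp: u_def v_def)
  have tuv: "t * u \<le> t * v" "t * u \<le> u"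
    using uv t_pos t_less_1 by simp_all
  have clip: "(2 * t - 1) * v = 2 * (t * v) - v"
    by (simp add: algebra_simps)
  \<comment> \<open>The vertex \<open>(u + v) / 2\<close> cannot lie to the left of the segment
    because \<open>t * u \<le> u\<close>; only the right end can cut it off.\<close>
  have y: "t * u \<le> y \<and> y \<le> t * v"
  proof (cases "u \<le> (2 * t - 1) * v")
    case True
    then have "y = (u + v) / 2" by (simp add: y_def)
    then have "u \<le> y" "y \<le> t * v" using True uv unfolding clip by simp_all
    then show ?thesis using tuv by simp
  next
    case False
    then have "y = t * v" unfolding y_def min_def clip by simp
    then show ?thesis using tuv by simp
  qed
  have "0 < t * u" using uv t_pos by simp
  have seg: "y \<in> {t * b (int (Suc i) - 1)..t * b (int (Suc i))}"
    using y by (simp add: u_def v_def)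
  have "noise_var \<epsilon> n p0 b y = energy b + ((u + v) * y - t * u * v - y\<^sup>2)"
    using noise_var_outer[OF b _ _ seg] i by (simp add: u_def v_def)
  also have "(u + v) * y - t * u * v - y\<^sup>2 = seg_peak t (min u ((2 * t - 1) * v)) v"
    unfolding y_def seg_peak_def min_def by (auto simp: power2_eq_square field_simps)
  finally have "energy b + seg_peak t (min u ((2 * t - 1) * v)) v = noise_var \<epsilon> n p0 b y"
    by simp
  also have "\<dots> \<le> worst_var \<epsilon> n p0 b"
    using noise_var_le_worst_var[OF b] segment_in_range[OF b, of "int (Suc i)" y] y i \<open>0 < t * u\<close>
    by (simp add: v_def)
  finally show ?thesis by (simp add: u_def v_def)
qed

text \<open>Stated for an arbitrary sequence, so that the hypothesis on the candidate turns directly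
  into a comparison of peaks.\<close>

lemma var_poly_first:
  "var_poly \<epsilon> n p0 b 1 (xstar_1 \<epsilon> n p0 b) = energy b + kappa * (b 1)\<^sup>2"
proof -
  have "(\<Sum>i\<in>{1..int n}. (b i)\<^sup>2 * p) = (b 1)\<^sup>2 * p + (\<Sum>i\<in>{2..int n}. (b i)\<^sup>2 * p)"
  proof -
    have "{1..int n} = insert 1 {2..int n}" using n_ge by auto
    then show ?thesis by simp
  qed
  then have e: "energy b = 2 * (b 1)\<^sup>2 * p + 2 * (\<Sum>i\<in>{2..int n}. (b i)\<^sup>2 * p)"
    unfolding energy_def sum_int_positive
    by (simp add: sum_distrib_left[symmetric] sum_distrib_right[symmetric] algebra_simps)
  define s where "s = (\<Sum>i\<in>{2..int n}. (b i)\<^sup>2 * p)"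
  have coeff: "exp \<epsilon> * p + p - 2 * mech_pstar \<epsilon> n p0 = (if N = 2 * n then 0 else t)"
    by (simp add: mech_pstar_eq t_eq field_simps)
  have "2 * (exp \<epsilon> - 1) * p = 2 * t" by (simp add: t_eq)
  then have "xstar_1 \<epsilon> n p0 b = (if N = 2 * n then 0 else b 1 / 2)"
    using t_pos unfolding xstar_1_def mech_p_eq coeff by simp
  then show ?thesis
    using t_pos unfolding var_poly_def Let_def mech_p_eq coeff e s_def[symmetric] t_eq[symmetric]
    by (simp add: mech_pstar_eq kappa_def power2_eq_square algebra_simps)
qed

lemma var_poly_last:
  "var_poly \<epsilon> n p0 b (int n) (xstar_n n b)
    = energy b + seg_peak t (b (int (n - 1))) (b (int n))"
proof -
  have pred: "int (n - 1) = int n - 1" using n_ge by simp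
  have e: "energy b = 2 * (\<Sum>i\<in>{1..int n}. (b i)\<^sup>2 * p)"
    unfolding energy_def sum_int_positive by (simp add: sum_distrib_right[symmetric])
  show ?thesis
    using n_ge unfolding e pred var_poly_def Let_def mech_p_eq t_eq[symmetric]
    by (simp add: xstar_n_def seg_peak_def power2_eq_square field_simps)
qed

end

section \<open>The candidate sequence and the equalizing sequence\<close>

text \<open>Superposition: \<open>cand_Q\<close> and \<open>cand_T\<close> are the fundamental
  solutions with top values 1, 0 and 0, 1.\<close>

lemma down_rec_linear: "down_rec t u v k = u * down_rec t 1 0 k + v * down_rec t 0 1 k"
  by (induction t u v k rule: down_rec.induct) (auto simp: algebra_simps)

lemma down_rec_step:
  assumes "i + 2 \<le> n"
  shows "down_rec t u v (n - i)
    = (4 * t - 2) * down_rec t u v (n - (i + 1)) - down_rec t u v (n - (i + 2))"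
proof -
  have "n - i = Suc (Suc (n - (i + 2)))" "n - (i + 1) = Suc (n - (i + 2))"
    using assms by auto
  then show ?thesis by simp
qed

lemma down_rec_unique:
  fixes x :: "nat \<Rightarrow> real"
  assumes rec: "\<And>i. 1 \<le> i \<Longrightarrow> i + 2 \<le> n \<Longrightarrow> x i = (4 * t - 2) * x (i + 1) - x (i + 2)"
    and "1 \<le> i" "i \<le> n"
  shows "x i = down_rec t (x n) (x (n - 1)) (n - i)"
proof -
  have "1 \<le> n - k \<Longrightarrow> k \<le> n \<Longrightarrow> x (n - k) = down_rec t (x n) (x (n - 1)) k" for k
  proof (induction k rule: induct_nat_012)
    case (ge2 k)
    then have "x (n - Suc (Suc k)) = (4 * t - 2) * x (n - Suc k) - x (n - k)"
      using rec[of "n - Suc (Suc k)"] by (simp add: Suc_diff_Suc numeral_2_eq_2)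
    then show ?case using ge2 by simp
  qed simp_all
  from this[of "n - i"] show ?thesis using assms by simp
qed

text \<open>The Casoratian \<open>x\<^sub>i y\<^sub>i\<^sub>+\<^sub>1 - x\<^sub>i\<^sub>+\<^sub>1 y\<^sub>i\<close> of two solutions is constant, so a solution that
  starts like \<open>0, 1\<close> stays positive as long as some other solution does.\<close>

lemma recurrence_solution_pos:
  fixes x y :: "nat \<Rightarrow> real"
  assumes x: "\<And>i. 1 \<le> i \<Longrightarrow> i + 2 \<le> n \<Longrightarrow> x i = m * x (i + 1) - x (i + 2)"
    and y: "\<And>i. 1 \<le> i \<Longrightarrow> i + 2 \<le> n \<Longrightarrow> y i = m * y (i + 1) - y (i + 2)"
    and pos: "\<And>i. 1 \<le> i \<Longrightarrow> i \<le> n \<Longrightarrow> 0 < x i"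
    and "y n = 0" "y (n - 1) = 1" "2 \<le> n" and i: "1 \<le> i" "i < n"
  shows "0 < y i"
proof -
  have "i \<le> n - 1" using i by simp
  then have "1 \<le> i \<longrightarrow> x i * y (Suc i) - x (Suc i) * y i = - x n \<and> 0 < y i"
  proof (induction i rule: inc_induct)
    case base
    have "Suc (n - 1) = n" using \<open>2 \<le> n\<close> by simp
    then show ?case using assms by simp
  next
    case (step i)
    show ?case
    proof
      assume "1 \<le> i"
      have xi: "x i = m * x (Suc i) - x (Suc (Suc i))"
        and yi: "y i = m * y (Suc i) - y (Suc (Suc i))"
        using x[of i] y[of i] \<open>1 \<le> i\<close> step by simp_all
      have ys: "0 < y (Suc i)"
        and "x (Suc i) * y (Suc (Suc i)) - x (Suc (Suc i)) * y (Suc i) = - x n"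
        using step by simp_all
      then have cas: "x i * y (Suc i) - x (Suc i) * y i = - x n"
        unfolding xi yi by (simp add: algebra_simps)
      have "0 < x i * y (Suc i)" "0 < x n" "0 < x (Suc i)"
        using pos[of i] pos[of n] pos[of "Suc i"] ys \<open>1 \<le> i\<close> step by auto
      then have "0 < x (Suc i) * y i" using cas by linarith
      then show "x i * y (Suc i) - x (Suc i) * y i = - x n \<and> 0 < y i"
        using cas \<open>0 < x (Suc i)\<close> by (simp add: zero_less_mult_iff)
    qed
  qed
  then show ?thesis using i by simp
qed

text \<open>The radicand is the square of \<open>2 * t - 1 - c\<close>, and
  \<open>c < 2 * t - 1\<close> selects the root. The result is the linear recurrence in ratio form:
  if \<open>c\<close> is the ratio of \<open>a i\<close> to \<open>a (i + 1)\<close>, the value is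
  the ratio of \<open>a (i + 1)\<close> to \<open>a (i + 2)\<close>.\<close>

lemma equalizing_step:
  fixes c t :: real
  assumes "0 < c" "c < 2 * t - 1"
  shows "(1 - 2 * t + sqrt (c\<^sup>2 + 2 * c - 4 * t * c + (2 * t - 1)\<^sup>2)) / (c\<^sup>2 + 2 * c - 4 * t * c)
    = 1 / (4 * t - 2 - c)"
proof -
  have "c\<^sup>2 + 2 * c - 4 * t * c + (2 * t - 1)\<^sup>2 = (2 * t - 1 - c)\<^sup>2"
    by (simp add: power2_eq_square algebra_simps)
  then have num: "1 - 2 * t + sqrt (c\<^sup>2 + 2 * c - 4 * t * c + (2 * t - 1)\<^sup>2) = - c"
    using assms by simp
  have den: "c\<^sup>2 + 2 * c - 4 * t * c = - c * (4 * t - 2 - c)"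
    by (simp add: power2_eq_square algebra_simps)
  show ?thesis by (subst num, subst den) (use assms in simp)
qed

theorem theorem5:
  fixes \<epsilon> p t p0 :: real and n N :: nat and C :: "nat \<Rightarrow> real" and a :: "int \<Rightarrow> real"
  assumes "\<epsilon> > 0" and "n \<ge> 2" and "N \<in> {2 * n, 2 * n + 1}"
    and "p = 1 / (exp \<epsilon> + real N - 1)" and "t = (exp \<epsilon> - 1) * p"
    and "p0 = (if N = 2 * n then 0 else p)"
    and "\<forall>j\<in>{0..int n - 1}. cand p t n j < cand p t n (j + 1)"
    and "var_poly \<epsilon> n p0 (cand p t n) 1 (xstar_1 \<epsilon> n p0 (cand p t n))
         > var_poly \<epsilon> n p0 (cand p t n) (int n) (xstar_n n (cand p t n))"
    and "C 1 = (if N = 2 * n then 1 / (4 * t - 1) else 1 / (4 * t - 2))"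
    and "\<forall>j\<in>{1..n - 2}. C (j + 1) =
           (1 - 2 * t + sqrt ((C j)\<^sup>2 + 2 * C j - 4 * t * C j + (2 * t - 1)\<^sup>2))
           / ((C j)\<^sup>2 + 2 * C j - 4 * t * C j)"
    and "a (int n) = 1 / t"
    and "\<forall>j\<in>{1..n - 1}. a (int j) = C j * a (int j + 1)"
    and "a 0 = 0"
    and "\<forall>j. a (- j) = - a j"
  shows "admissible \<epsilon> n p0 a \<and>
         (\<forall>b. admissible \<epsilon> n p0 b \<longrightarrow> worst_var \<epsilon> n p0 a \<le> worst_var \<epsilon> n p0 b)"
proof -
  interpret structured_mechanism \<epsilon> p t p0 n N
    using assms(1-6) by unfold_locales

  \<comment> \<open>The candidate: fundamental solutions and stationarity along
    \<open>T\<close>\<close>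
  define c where "c i = cand p t n (int i)" for i
  define A where "A i = a (int i)" for i
  define T where "T = cand_T t n"
  define Q where "Q = cand_Q t n"
  have c_pos_eq: "c i = cand_pos p t n i" if "1 \<le> i" for i
    using that by (simp add: c_def cand_def)
  have c0: "c 0 = 0" by (simp add: c_def cand_def)
  have T: "T n = 0" "T (n - 1) = 1"
    using n_ge by (simp_all add: T_def cand_T_def)
  have Trec: "T i = (4 * t - 2) * T (i + 1) - T (i + 2)" if "1 \<le> i" "i + 2 \<le> n" for i
    unfolding T_def cand_T_def using that by (intro down_rec_step)
  have crec: "c i = (4 * t - 2) * c (i + 1) - c (i + 2)" if "1 \<le> i" "i + 2 \<le> n" for i
    using that by (simp only: c_pos_eq cand_pos_def trans_le_add1 down_rec_step[OF that(2)])
  have cn: "c n = 1 / t" using n_ge by (simp add: c_pos_eq cand_pos_def)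
  have c_lin: "c i = c n * Q i + c (n - 1) * T i" if "1 \<le> i" "i \<le> n" for i
    using down_rec_unique[of n c t i] crec that down_rec_linear[of t "c n" "c (n - 1)" "n - i"]
    by (simp add: T_def Q_def cand_T_def cand_Q_def)
  have "c (n - 1) = ((2 * t - 1) - 8 * p * (\<Sum>k=1..n. T k * Q k))
      / (1 + 8 * p * (\<Sum>k=1..n. (T k)\<^sup>2)) * c n"
    using n_ge by (simp add: c_pos_eq cand_pos_def T_def Q_def)
  moreover have "0 < 1 + 8 * p * (\<Sum>k=1..n. (T k)\<^sup>2)"
    using p_pos by (intro add_pos_nonneg mult_nonneg_nonneg sum_nonneg) auto
  ultimately have c_pred: "c (n - 1) * (1 + 8 * p * (\<Sum>k=1..n. (T k)\<^sup>2))
      = ((2 * t - 1) - 8 * p * (\<Sum>k=1..n. T k * Q k)) * c n"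
    by simp
  have drop_n: "(\<Sum>i=1..n. x i * T i) = (\<Sum>i=1..<n. x i * T i)" for x :: "nat \<Rightarrow> real"
  proof -
    have "{1..n} = insert n {1..<n}" using n_ge by auto
    then show ?thesis using T by simp
  qed
  have "(\<Sum>i=1..n. c i * T i) = (\<Sum>i=1..n. c n * (T i * Q i) + c (n - 1) * (T i)\<^sup>2)"
  proof (rule sum.cong)
    fix i assume "i \<in> {1..n}"
    then have "c i = c n * Q i + c (n - 1) * T i" using c_lin[of i] by simp
    then have "c i * T i = (c n * Q i + c (n - 1) * T i) * T i" by (rule arg_cong)
    then show "c i * T i = c n * (T i * Q i) + c (n - 1) * (T i)\<^sup>2"
      by (simp only: power2_eq_square algebra_simps)
  qed simp
  then have sum_cT: "(\<Sum>i=1..<n. c i * T i)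
      = c n * (\<Sum>i=1..n. T i * Q i) + c (n - 1) * (\<Sum>i=1..n. (T i)\<^sup>2)"
    by (simp only: drop_n sum.distrib flip: sum_distrib_left)
  \<comment> \<open>The closed form of \<open>c (n - 1)\<close> says precisely that the derivative
    along \<open>T\<close> of the last peak plus \<open>2 * p\<close> times the sum of squares
    vanishes.\<close>
  have c_stat: "c (n - 1) / 2 + (1 / 2 - t) * c n + 4 * p * (\<Sum>i=1..<n. c i * T i) = 0"
    unfolding sum_cT using c_pred by (simp add: algebra_simps)

  \<comment> \<open>Positivity and clipping of the candidate\<close>
  have c_less: "c i < c (Suc i)" if "i < n" for i
    using assms(7) that by (auto simp: c_def add.commute)
  have c_pos: "0 < c i" if "1 \<le> i" "i \<le> n" for i
    using that
  proof (induction i rule: dec_induct)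
    case base
    then show ?case using c_less[of 0] n_ge c0 by simp
  next
    case (step i)
    then show ?case using c_less[of i] by simp
  qed
  have T_pos: "0 < T i" if "1 \<le> i" "i < n" for i
    using recurrence_solution_pos[of n c "4 * t - 2" T i] crec Trec c_pos T n_ge that by blast
  \<comment> \<open>In \<open>c_stat\<close> the sum is positive, so the derivative of the last peak
    must be negative.\<close>
  have c_last: "c (n - 1) < (2 * t - 1) * c n"
  proof -
    have "0 < (\<Sum>i=1..<n. c i * T i)"
      using n_ge by (intro sum_pos mult_pos_pos) (auto simp: c_pos T_pos simp del: One_nat_def)
    then have "0 < 4 * p * (\<Sum>i=1..<n. c i * T i)" using p_pos by simp
    then have "c (n - 1) / 2 + (1 / 2 - t) * c n < 0" using c_stat by linarith
    then show ?thesis by (simp add: algebra_simps)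
  qed
  have t_half: "0 < 2 * t - 1"
  proof -
    have "0 < c (n - 1)" using n_ge by (intro c_pos) auto
    then have "0 < (2 * t - 1) * c n" using c_last by linarith
    then show ?thesis using c_pos[of n] n_ge by (simp add: zero_less_mult_iff)
  qed
  \<comment> \<open>Downward induction: \<open>c i\<close> is \<open>(4 * t - 2) * c (Suc i)\<close>
    minus \<open>c (Suc (Suc i))\<close>, and the latter exceeds
    \<open>(2 * t - 1) * c (Suc i)\<close> by monotonicity.\<close>
  have c_clip: "c i < (2 * t - 1) * c (Suc i)" if i: "1 \<le> i" "i < n" for i
  proof -
    have "i \<le> n - 1" using i by simp
    then have "1 \<le> i \<longrightarrow> c i < (2 * t - 1) * c (Suc i)"
    proof (induction i rule: inc_induct)
      case base
      then show ?case using c_last n_ge by simp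
    next
      case (step i)
      show ?case
      proof
        assume "1 \<le> i"
        have sn: "Suc i < n" using step by auto
        then have "0 < c (Suc i)" by (intro c_pos) auto
        then have "(2 * t - 1) * c (Suc i) \<le> 1 * c (Suc i)"
          using t_less_1 by (intro mult_right_mono) auto
        then have "(2 * t - 1) * c (Suc i) < c (Suc (Suc i))"
          using c_less[OF sn] by simp
        moreover have "c i = (4 * t - 2) * c (Suc i) - c (Suc (Suc i))"
          using crec[of i] \<open>1 \<le> i\<close> sn by simp
        ultimately show "c i < (2 * t - 1) * c (Suc i)" by (simp add: algebra_simps)
      qed
    qed
    then show ?thesis using i by simp
  qed

  \<comment> \<open>Comparison of the ratios \<open>C\<close> with those of the candidate\<close>
  have kappa_t: "kappa = t" if "N = 2 * n" unfolding kappa_def using that by simp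
  have kappa_quarter: "kappa = 1 / 4" if "N \<noteq> 2 * n" unfolding kappa_def using that by simp
  have peak_c: "kappa * (c 1)\<^sup>2 > seg_peak t (c 1) (c 2)"
  proof -
    have "kappa * (c 1)\<^sup>2 > seg_peak t (c (n - 1)) (c (Suc (n - 1)))"
      using assms(8) n_ge unfolding var_poly_first var_poly_last by (simp add: c_def)
    moreover have "1 \<le> n - 1" "n - 1 < n" using n_ge by auto
    \<comment> \<open>The first integral carries the last peak of the candidate down to the pair
      \<open>(c 1, c 2)\<close>.\<close>
    ultimately show ?thesis
      using peak_polar_recurrence_const[of n c t c "n - 1"] crec by (simp add: seg_peak_conv_polar)
  qed
  have C1: "0 < C 1" "C 1 * c 2 < c 1"
  proof -
    have pos: "0 < c 1" "0 < c 2" using c_pos n_ge by simp_all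
    have recip: "0 < x \<and> x * v < u" if "x = 1 / d" "0 < d" "0 < d * u - v" for x d u v :: real
      unfolding that(1) using that(2,3) by (simp add: field_simps)
    have "0 < C 1 \<and> C 1 * c 2 < c 1"
    proof (cases "N = 2 * n")
      case True
      \<comment> \<open>The difference of the peaks factors, and its sign compares
        \<open>c 1 / c 2\<close> with \<open>1 / (4 * t - 1)\<close>, the value of
        \<open>C 1\<close>.\<close>
      have "t * (c 1)\<^sup>2 - seg_peak t (c 1) (c 2) = ((4 * t - 1) * c 1 - c 2) * (c 1 + c 2) / 4"
        by (simp add: seg_peak_def power2_eq_square field_simps)
      then have "0 < ((4 * t - 1) * c 1 - c 2) * (c 1 + c 2)"
        using peak_c unfolding kappa_t[OF True] by simp
      then have "0 < (4 * t - 1) * c 1 - c 2" using pos by (simp add: zero_less_mult_iff)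
      then show ?thesis using True t_half assms(9) by (intro recip[of _ "4 * t - 1"]) auto
    next
      case False
      have "1 / 4 * (c 1)\<^sup>2 - seg_peak t (c 1) (c 2) = ((4 * t - 2) * c 1 - c 2) * c 2 / 4"
        by (simp add: seg_peak_def power2_eq_square field_simps)
      then have "0 < ((4 * t - 2) * c 1 - c 2) * c 2"
        using peak_c unfolding kappa_quarter[OF False] by simp
      then have "0 < (4 * t - 2) * c 1 - c 2" using pos by (simp add: zero_less_mult_iff)
      then show ?thesis using False t_half assms(9) by (intro recip[of _ "4 * t - 2"]) auto
    qed
    then show "0 < C 1" "C 1 * c 2 < c 1" by simp_all
  qed
  have C_less_of: "C i < 2 * t - 1" if "C i * c (Suc i) < c i" "1 \<le> i" "i < n" for i
  proof -
    have "C i * c (Suc i) < (2 * t - 1) * c (Suc i)" using that c_clip[of i] by simp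
    then show ?thesis using c_pos[of "Suc i"] that by simp
  qed
  have C_Suc_of: "C (Suc i) = 1 / (4 * t - 2 - C i)"
    if "0 < C i" "C i < 2 * t - 1" "1 \<le> i" "Suc i < n" for i
  proof -
    have "i \<in> {1..n - 2}" using that by auto
    then show ?thesis using assms(10) equalizing_step[OF that(1,2)] by simp
  qed
  \<comment> \<open>The ratios of \<open>c\<close> follow the same map
    \<open>x \<mapsto> 1 / (4 * t - 2 - x)\<close>, which is increasing on the relevant range, so
    the strict inequality at 1 persists.\<close>
  have C: "i < n \<longrightarrow> 0 < C i \<and> C i * c (Suc i) < c i" if "1 \<le> i" for i
    using that
  proof (induction i rule: dec_induct)
    case base
    then show ?case using C1 by (simp add: numeral_2_eq_2)
  next
    case (step i)
    show ?case
    proof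
      assume "Suc i < n"
      then have Ci: "0 < C i" "C i * c (Suc i) < c i" using step by auto
      have lt: "C i < 2 * t - 1" using C_less_of[OF Ci(2)] step \<open>Suc i < n\<close> by simp
      have Cs: "C (Suc i) = 1 / (4 * t - 2 - C i)"
        using C_Suc_of[OF Ci(1) lt] step \<open>Suc i < n\<close> by simp
      have den: "0 < 4 * t - 2 - C i" using lt t_half by simp
      have "c i = (4 * t - 2) * c (Suc i) - c (Suc (Suc i))"
        using crec[of i] step \<open>Suc i < n\<close> by simp
      then have "c (Suc (Suc i)) < (4 * t - 2 - C i) * c (Suc i)"
        using Ci(2) by (simp add: algebra_simps)
      then show "0 < C (Suc i) \<and> C (Suc i) * c (Suc (Suc i)) < c (Suc i)"
        using den unfolding Cs by (simp add: field_simps)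
    qed
  qed
  have C_less: "C i < 2 * t - 1" if "1 \<le> i" "i < n" for i
    using C_less_of[of i] C[of i] that by simp

  \<comment> \<open>The equalizing sequence: order, linear recurrence, equal peaks\<close>
  have A_step: "A i = C i * A (Suc i)" if "1 \<le> i" "i < n" for i
  proof -
    have "i \<in> {1..n - 1}" using that by auto
    then show ?thesis using assms(12) by (simp add: A_def add.commute)
  qed
  have An: "A n = 1 / t" using assms(11) by (simp add: A_def)
  have A_pos: "0 < A i" if i: "1 \<le> i" "i \<le> n" for i
  proof -
    from i(2) have "1 \<le> i \<longrightarrow> 0 < A i"
    proof (induction i rule: inc_induct)
      case base
      then show ?case using An t_pos by simp
    next
      case (step i)
      then show ?case using A_step[of i] C[of i] by simp
    qed
    then show ?thesis using i by simp
  qed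
  have A_clip: "A i < (2 * t - 1) * A (Suc i)" if "1 \<le> i" "i < n" for i
    unfolding A_step[OF that] using C_less[OF that] A_pos[of "Suc i"] that
    by (intro mult_strict_right_mono) auto
  have A_less: "A i < A (Suc i)" if "i < n" for i
  proof (cases "i = 0")
    case True
    then show ?thesis using A_pos[of 1] n_ge assms(13) by (simp add: A_def)
  next
    case False
    then have "A i < (2 * t - 1) * A (Suc i)" using A_clip that by simp
    also have "\<dots> \<le> 1 * A (Suc i)"
      using A_pos[of "Suc i"] that t_less_1 by (intro mult_right_mono) auto
    finally show ?thesis by simp
  qed
  have Arec: "A i = (4 * t - 2) * A (i + 1) - A (i + 2)" if "1 \<le> i" "i + 2 \<le> n" for i
  proof -
    have "0 < 4 * t - 2 - C i" using C_less[of i] that t_half by simp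
    moreover have "A (Suc i) = 1 / (4 * t - 2 - C i) * A (Suc (Suc i))"
      using A_step[of "Suc i"] C_Suc_of[of i] C_less[of i] C[of i] that by simp
    ultimately have "A (Suc (Suc i)) = (4 * t - 2 - C i) * A (Suc i)" by simp
    then show ?thesis using A_step[of i] that by (simp add: algebra_simps)
  qed
  \<comment> \<open>\<open>C 1\<close> is the ratio at which the factor compared above for the
    candidate becomes zero.\<close>
  have first_peak: "seg_peak t (A 1) (A 2) = kappa * (A 1)\<^sup>2"
  proof -
    have A1: "A 1 = C 1 * A 2" using A_step[of 1] n_ge by (simp add: numeral_2_eq_2)
    show ?thesis
    proof (cases "N = 2 * n")
      case True
      have A2: "A 2 = (4 * t - 1) * A 1" using A1 True t_half assms(9) by simp
      show ?thesis
        unfolding kappa_t[OF True] A2 by (simp add: seg_peak_def power2_eq_square field_simps)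
    next
      case False
      have A2: "A 2 = (4 * t - 2) * A 1" using A1 False t_half assms(9) by simp
      show ?thesis
        unfolding kappa_quarter[OF False] A2 by (simp add: seg_peak_def power2_eq_square field_simps)
    qed
  qed
  have peaks: "seg_peak t (A i) (A (Suc i)) = kappa * (A 1)\<^sup>2" if "1 \<le> i" "i < n" for i
    using peak_polar_recurrence_const[of n A t A i] Arec that first_peak
    by (simp add: seg_peak_conv_polar)

  \<comment> \<open>Descent along \<open>T\<close> at the equalizing sequence\<close>
  have A_dev: "A i = c i + (A (n - 1) - c (n - 1)) * T i" if "1 \<le> i" "i \<le> n" for i
  proof -
    have "A i = A n * Q i + A (n - 1) * T i"
      using down_rec_unique[of n A t i] Arec that down_rec_linear[of t "A n" "A (n - 1)" "n - i"]
      by (simp add: T_def Q_def cand_T_def cand_Q_def)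
    then show ?thesis using c_lin[OF that] An cn by (simp add: algebra_simps)
  qed
  have A_pred: "A (n - 1) < c (n - 1)"
  proof -
    have "1 \<le> n - 1" "n - 1 < n" "Suc (n - 1) = n" using n_ge by auto
    then have "A (n - 1) = C (n - 1) * c n" "C (n - 1) * c n < c (n - 1)"
      using A_step[of "n - 1"] C[of "n - 1"] An cn by simp_all
    then show ?thesis by simp
  qed
  \<comment> \<open>The derivative along \<open>T\<close> is 0 at \<open>c\<close> and grows with
    the parameter on the line; \<open>A\<close> lies at the negative parameter
    \<open>s\<close>.\<close>
  have slope: "A (n - 1) / 2 + (1 / 2 - t) * A n + 4 * p * (\<Sum>i=1..<n. A i * T i) \<le> 0"
  proof -
    define s where "s = A (n - 1) - c (n - 1)"
    have "(\<Sum>i=1..<n. A i * T i) = (\<Sum>i=1..<n. c i * T i + s * (T i)\<^sup>2)"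
    proof (rule sum.cong)
      fix i assume "i \<in> {1..<n}"
      then have "A i = c i + s * T i" using A_dev[of i] unfolding s_def by simp
      then have "A i * T i = (c i + s * T i) * T i" by (rule arg_cong)
      then show "A i * T i = c i * T i + s * (T i)\<^sup>2"
        by (simp only: power2_eq_square algebra_simps)
    qed simp
    then have sum_AT: "(\<Sum>i=1..<n. A i * T i) = (\<Sum>i=1..<n. c i * T i) + s * (\<Sum>i=1..<n. (T i)\<^sup>2)"
      by (simp only: sum.distrib sum_distrib_left)
    have "A (n - 1) / 2 + (1 / 2 - t) * A n + 4 * p * (\<Sum>i=1..<n. A i * T i)
        = c (n - 1) / 2 + (1 / 2 - t) * c n + 4 * p * (\<Sum>i=1..<n. c i * T i)
          + s * (1 / 2 + 4 * p * (\<Sum>i=1..<n. (T i)\<^sup>2))"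
      unfolding sum_AT An cn by (simp add: s_def field_simps)
    also have "\<dots> \<le> 0"
      unfolding c_stat using A_pred p_pos
      by (simp add: s_def mult_nonpos_nonneg add_nonneg_nonneg sum_nonneg)
    finally show ?thesis .
  qed

  \<comment> \<open>Admissibility and the worst-case variance of the equalizing sequence\<close>
  have adm: "admissible \<epsilon> n p0 a"
    unfolding admissible_def
  proof (intro conjI ballI)
    fix i assume i: "i \<in> {- int n..<int n}"
    show "a i < a (i + 1)"
    proof (cases "0 \<le> i")
      case True
      then show ?thesis using A_less[of "nat i"] i by (simp add: A_def add.commute)
    next
      case False
      have "a (- (i + 1)) < a (- i)"
        using A_less[of "nat (- i - 1)"] i False by (simp add: A_def)
      then show ?thesis using assms(14) by (metis neg_less_iff_less)
    qed
  qed (use assms(11,13,14) in auto)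
  have upper: "worst_var \<epsilon> n p0 a \<le> energy a + kappa * (A 1)\<^sup>2"
    using peaks by (intro worst_var_le adm) (auto simp: A_def)

  \<comment> \<open>Comparison with an arbitrary admissible output set\<close>
  have "worst_var \<epsilon> n p0 a \<le> worst_var \<epsilon> n p0 b" if b: "admissible \<epsilon> n p0 b" for b
  proof -
    obtain l :: "nat \<Rightarrow> real" where l: "\<And>i. 1 \<le> i \<Longrightarrow> i \<le> n \<Longrightarrow> 0 \<le> l i"
        "l 1 + (\<Sum>j=1..<n. l (Suc j)) = 1"
        "\<And>i. 1 \<le> i \<Longrightarrow> i < n \<Longrightarrow>
          l i * (if i = 1 then 2 * kappa * A 1 else A i / 2 + (1 / 2 - t) * A (i - 1))
          + l (Suc i) * (A i / 2 + (1 / 2 - t) * A (Suc i)) + 4 * p * A i = 0"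
      using ex_stationary_weights[OF n_ge less_imp_le[OF p_pos] kappa_pos t_less_1 A_pos A_clip Arec Trec
          T T_pos[of 1] slope] n_ge by auto
    have "2 * p * (\<Sum>i=1..n. (A i)\<^sup>2) + kappa * (A 1)\<^sup>2 \<le> worst_var \<epsilon> n p0 b"
    proof (rule weighted_peak_bound[where b = "\<lambda>i. b (int i)" and l = l])
      show "b (int n) = A n" using admissibleD(2)[OF b] An by simp
      show "2 * p * (\<Sum>i=1..n. (b (int i))\<^sup>2) + kappa * (b (int 1))\<^sup>2 \<le> worst_var \<epsilon> n p0 b"
        using worst_var_ge_inner[OF b] t_half by (simp add: energy_def)
      show "2 * p * (\<Sum>i=1..n. (b (int i))\<^sup>2)
          + seg_peak t (min (b (int i)) ((2 * t - 1) * b (int (Suc i)))) (b (int (Suc i)))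
          \<le> worst_var \<epsilon> n p0 b" if "1 \<le> i" "i < n" for i
        using worst_var_ge_outer[OF b that] by (simp add: energy_def)
      show "A i \<le> (2 * t - 1) * A (Suc i)" if "1 \<le> i" "i < n" for i
        using A_clip[OF that] by simp
    qed (use l peaks n_ge p_pos kappa_pos t_pos t_less_1 in \<open>simp_all only: less_imp_le\<close>)
    then show ?thesis using upper by (simp add: energy_def A_def)
  qed
  then show ?thesis using adm by blast
qed

end
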